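(* For $r=1,2,4$, the Lie algebra $\mathcal N_{r,r}=V^{r,r}\oplus\mathbb R^{r,r}$ admits a Lie algebra automorphism $\Psi=A\oplus C\colon V^{r,r}\oplus\mathbb R^{r,r}\to V^{r,r}\oplus\mathbb R^{r,r}$ with $CC^{\tau}=-\mathrm{Id}$.
   Context: $\mathbb R^{r,s}$ denotes $\mathbb R^{r+s}$ with the symmetric bilinear form $\langle x,y\rangle_{r,s}=\sum_{i=1}^r x_iy_i-\sum_{j=1}^s x_{r+j}y_{r+j}$, and $\mathrm{Cl}_{r,s}$ is the Clifford algebra it generates with the convention $x\otimes x=-\langle x,x\rangle_{r,s}$. A $\mathrm{Cl}_{r,s}$-module is a finite-dimensional real vector space $U$ with a linear map $J\colon\mathbb R^{r,s}\to\mathrm{End}(U)$ such that $J_z^2=-\langle z,z\rangle_{r,s}\mathrm{Id}_U$. It is admissible if equipped with a non-degenerate symmetric bilinear form $\langle\cdot,\cdot\rangle_U$ with $\langle J_zx,y\rangle_U+\langle x,J_zy\rangle_U=0$ for all $z,x,y$; minimal admissible (denoted $V^{r,s}$) means (nonzero) admissible of the smallest possible dimension. $\mathcal N_{r,s}(U)=U\oplus\mathbb R^{r,s}$ is the 2-step nilpotent Lie algebra with centre $\mathbb R^{r,s}$ and bracket $[U,U]\subset\mathbb R^{r,s}$ given by $\langle J_zx,y\rangle_U=\langle z,[x,y]\rangle_{r,s}$; $\mathcal N_{r,s}=\mathcal N_{r,s}(V^{r,s})$. $A\oplus C$ denotes the block diagonal map $(x,z)\mapsto(A(x),C(z))$ with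 $A\colon V^{r,r}\to V^{r,r}$, $C\colon\mathbb R^{r,r}\to\mathbb R^{r,r}$ linear, and $C^{\tau}$ is the adjoint of $C$ with respect to $\langle\cdot,\cdot\rangle_{r,r}$. *)

theory Defs
  imports "HOL-Analysis.Analysis"
begin

section \<open>Linear maps between subspaces\<close>

text \<open>
  Modules are carried by finite-dimensional subspaces of an ambient real vector space, so that
  modules of different dimensions live in one type. Outside the carrier, maps are arbitrary.
\<close>

definition linear_map_on ::
    "'u::real_vector set \<Rightarrow> 'v::real_vector set \<Rightarrow> ('u \<Rightarrow> 'v) \<Rightarrow> bool" where
  "linear_map_on V W f \<longleftrightarrow>
     (\<forall>x\<in>V. f x \<in> W) \<and>
     (\<forall>x\<in>V. \<forall>y\<in>V. f (x + y) = f x + f y) \<and>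
     (\<forall>c. \<forall>x\<in>V. f (c *\<^sub>R x) = c *\<^sub>R f x)"

definition bilinear_form_on :: "'u::real_vector set \<Rightarrow> ('u \<Rightarrow> 'u \<Rightarrow> real) \<Rightarrow> bool" where
  "bilinear_form_on U b \<longleftrightarrow>
     (\<forall>x\<in>U. linear_map_on U UNIV (b x) \<and> linear_map_on U UNIV (\<lambda>y. b y x))"


section \<open>The space \<open>\<real>\<^bsup>r,s\<^esup>\<close>\<close>

text \<open>
  \<open>\<real>\<^bsup>r,s\<^esup>\<close> is \<open>real ^ ('r + 's)\<close> with \<open>CARD('r) = r\<close> and \<open>CARD('s) = s\<close>.
\<close>

definition pform :: "real ^ ('r::finite + 's::finite) \<Rightarrow> real ^ ('r + 's) \<Rightarrow> real" where
  "pform x y = (\<Sum>i\<in>UNIV. x $ Inl i * y $ Inl i) - (\<Sum>j\<in>UNIV. x $ Inr j * y $ Inr j)"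

definition pform_adjoint ::
    "(real ^ ('r::finite + 's::finite) \<Rightarrow> real ^ ('r + 's)) \<Rightarrow>
      real ^ ('r + 's) \<Rightarrow> real ^ ('r + 's)" where
  "pform_adjoint C = (THE D. \<forall>x y. pform (C x) y = pform x (D y))"


section \<open>Clifford modules\<close>

definition clifford_module ::
    "'u::real_vector set \<Rightarrow> (real ^ ('r::finite + 's::finite) \<Rightarrow> 'u \<Rightarrow> 'u) \<Rightarrow> bool" where
  "clifford_module U J \<longleftrightarrow>
     (\<exists>B. finite B \<and> U = span B) \<and>
     (\<forall>z. linear_map_on U U (J z)) \<and>
     (\<forall>x\<in>U. linear (\<lambda>z. J z x)) \<and>
     (\<forall>z. \<forall>x\<in>U. J z (J z x) = - pform z z *\<^sub>R x)"

definition admissible_module ::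
    "'u::real_vector set \<Rightarrow> (real ^ ('r::finite + 's::finite) \<Rightarrow> 'u \<Rightarrow> 'u) \<Rightarrow>
      ('u \<Rightarrow> 'u \<Rightarrow> real) \<Rightarrow> bool" where
  "admissible_module U J b \<longleftrightarrow>
     clifford_module U J \<and>
     bilinear_form_on U b \<and>
     (\<forall>x\<in>U. \<forall>y\<in>U. b x y = b y x) \<and>
     (\<forall>x\<in>U. (\<forall>y\<in>U. b x y = 0) \<longrightarrow> x = 0) \<and>
     (\<forall>z. \<forall>x\<in>U. \<forall>y\<in>U. b (J z x) y + b x (J z y) = 0)"

text \<open>
  The competitors \<open>W\<close> are nonzero admissible modules with an action \<open>J'\<close> and a form \<open>b'\<close> of
  their own, unrelated to \<open>J\<close> and \<open>b\<close>. It suffices to let \<open>W\<close> range over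
  subspaces of the ambient type of \<open>U\<close>, because an admissible module of dimension smaller than
  \<open>dim U\<close> is isomorphic to one carried by a subspace of \<open>U\<close>; see \<open>minimal_admissible_dim_le\<close>
  below, where the competing module has an arbitrary ambient type.
\<close>

definition minimal_admissible_module ::
    "'u::real_vector set \<Rightarrow> (real ^ ('r::finite + 's::finite) \<Rightarrow> 'u \<Rightarrow> 'u) \<Rightarrow>
      ('u \<Rightarrow> 'u \<Rightarrow> real) \<Rightarrow> bool" where
  "minimal_admissible_module U J b \<longleftrightarrow>
     admissible_module U J b \<and> U \<noteq> {0} \<and>
     (\<forall>(W :: 'u set) (J' :: real ^ ('r + 's) \<Rightarrow> 'u \<Rightarrow> 'u) b'.
        admissible_module W J' b' \<and> W \<noteq> {0} \<longrightarrow> dim U \<le> dim W)"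


section \<open>Lie algebras\<close>

definition lie_algebra_on :: "'l::real_vector set \<Rightarrow> ('l \<Rightarrow> 'l \<Rightarrow> 'l) \<Rightarrow> bool" where
  "lie_algebra_on L br \<longleftrightarrow>
     subspace L \<and>
     (\<forall>x\<in>L. linear_map_on L L (br x) \<and> linear_map_on L L (\<lambda>y. br y x)) \<and>
     (\<forall>x\<in>L. br x x = 0) \<and>
     (\<forall>x\<in>L. \<forall>y\<in>L. \<forall>z\<in>L. br x (br y z) + br y (br z x) + br z (br x y) = 0)"

definition lie_algebra_automorphism_on ::
    "'l::real_vector set \<Rightarrow> ('l \<Rightarrow> 'l \<Rightarrow> 'l) \<Rightarrow> ('l \<Rightarrow> 'l) \<Rightarrow> bool" where
  "lie_algebra_automorphism_on L br \<Psi> \<longleftrightarrow>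
     linear_map_on L L \<Psi> \<and> bij_betw \<Psi> L L \<and>
     (\<forall>x\<in>L. \<forall>y\<in>L. \<Psi> (br x y) = br (\<Psi> x) (\<Psi> y))"

definition module_bracket ::
    "(real ^ ('r::finite + 's::finite) \<Rightarrow> 'u \<Rightarrow> 'u) \<Rightarrow> ('u \<Rightarrow> 'u \<Rightarrow> real) \<Rightarrow>
      'u \<Rightarrow> 'u \<Rightarrow> real ^ ('r + 's)" where
  "module_bracket J b x y = (THE w. \<forall>z. b (J z x) y = pform z w)"

text \<open>\<open>\<N>\<^bsub>r,s\<^esub>(U)\<close> has carrier \<open>U \<times> UNIV\<close> and the bracket \<open>N_bracket J b\<close>.\<close>

abbreviation N_carrier ::
    "'u::real_vector set \<Rightarrow> ('u \<times> (real ^ ('r::finite + 's::finite))) set" where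
  "N_carrier U \<equiv> U \<times> UNIV"

definition N_bracket ::
    "(real ^ ('r::finite + 's::finite) \<Rightarrow> 'u \<Rightarrow> 'u) \<Rightarrow> ('u::real_vector \<Rightarrow> 'u \<Rightarrow> real) \<Rightarrow>
      'u \<times> (real ^ ('r + 's)) \<Rightarrow> 'u \<times> (real ^ ('r + 's)) \<Rightarrow> 'u \<times> (real ^ ('r + 's))" where
  "N_bracket J b p q = (0, module_bracket J b (fst p) (fst q))"


section \<open>The definite descriptions and the minimality are well behaved\<close>

definition psign :: "real ^ ('r::finite + 's::finite) \<Rightarrow> real ^ ('r + 's)" where
  "psign y = (\<chi> i. case i of Inl _ \<Rightarrow> y $ i | Inr _ \<Rightarrow> - (y $ i))"

lemma pform_eq_inner: "pform x y = x \<bullet> psign y"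
  by (simp add: pform_def inner_vec_def psign_def UNIV_Plus_UNIV[symmetric] Plus_def
      sum.union_disjoint sum.reindex sum_negf del: UNIV_Plus_UNIV)
     (subst sum.union_disjoint; force simp: sum.reindex sum_negf)

lemma psign_psign [simp]: "psign (psign y) = y"
  by (simp add: psign_def vec_eq_iff split: sum.split)

lemma pform_nondegenerate:
  assumes "\<And>z. pform z v = pform z w" shows "v = w"
proof -
  have "\<And>z. z \<bullet> psign v = z \<bullet> psign w" using assms by (simp add: pform_eq_inner)
  then have "psign v = psign w" by (metis vector_eq_rdot inner_commute)
  then show ?thesis by (metis psign_psign)
qed

lemma pform_representation:
  fixes f :: "real ^ ('r::finite + 's::finite) \<Rightarrow> real"
  assumes "linear f" shows "\<exists>!w. \<forall>z. f z = pform z w"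
proof (rule ex_ex1I)
  have "f z = pform z (psign (adjoint f 1))" for z
    using adjoint_works[OF assms, of z 1] by (simp add: pform_eq_inner)
  then show "\<exists>w. \<forall>z. f z = pform z w" by blast
qed (metis pform_nondegenerate)

lemma pform_adjoint_works:
  fixes C :: "real ^ ('r::finite + 's::finite) \<Rightarrow> real ^ ('r + 's)"
  assumes "linear C" shows "pform (C x) y = pform x (pform_adjoint C y)"
proof -
  have "\<exists>w. \<forall>z. pform (C z) y = pform z w" for y
  proof -
    have "linear (\<lambda>z. pform (C z) y)"
      unfolding pform_eq_inner using assms
      by (simp add: linear_iff inner_add_left)
    from pform_representation[OF this] show ?thesis by blast
  qed
  then obtain D where D: "\<forall>x y. pform (C x) y = pform x (D y)" by metis
  have "\<exists>!D. \<forall>x y. pform (C x) y = pform x (D y)"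
    using D by (intro ex_ex1I ext) (auto intro: pform_nondegenerate)
  from theI'[OF this] show ?thesis unfolding pform_adjoint_def by blast
qed

lemma module_bracket_works:
  assumes "admissible_module U J b" "x \<in> U" "y \<in> U"
  shows "b (J z x) y = pform z (module_bracket J b x y)"
proof -
  have J: "linear (\<lambda>z. J z x)" "\<And>z. J z x \<in> U" and b: "linear_map_on U UNIV (\<lambda>x. b x y)"
    using assms by (auto simp: admissible_module_def clifford_module_def bilinear_form_on_def
        linear_map_on_def)
  have "linear (\<lambda>z. b (J z x) y)"
    using J b by (simp add: linear_iff linear_map_on_def)
  from theI'[OF pform_representation[OF this]] show ?thesis
    unfolding module_bracket_def by blast
qed

lemma lie_algebra_N:
  assumes adm: "admissible_module U (J :: real ^ ('r::finite + 's::finite) \<Rightarrow> 'u \<Rightarrow> 'u::real_vector) b"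
  shows "lie_algebra_on (N_carrier U) (N_bracket J b)"
proof -
  note bw = module_bracket_works[OF adm]
  have U: "subspace U"
    using adm by (auto simp: admissible_module_def clifford_module_def)
  note Ua = subspace_add[OF U] and Us = subspace_scale[OF U] and U0 = subspace_0[OF U]
  have JU: "\<And>z x. x \<in> U \<Longrightarrow> J z x \<in> U"
    and Ja: "\<And>z x y. x \<in> U \<Longrightarrow> y \<in> U \<Longrightarrow> J z (x + y) = J z x + J z y"
    and Js: "\<And>z x c. x \<in> U \<Longrightarrow> J z (c *\<^sub>R x) = c *\<^sub>R J z x"
    and ba1: "\<And>x y w. x \<in> U \<Longrightarrow> y \<in> U \<Longrightarrow> w \<in> U \<Longrightarrow> b (x + y) w = b x w + b y w"
    and ba2: "\<And>x y w. x \<in> U \<Longrightarrow> y \<in> U \<Longrightarrow> w \<in> U \<Longrightarrow> b w (x + y) = b w x + b w y"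
    and bs1: "\<And>c x w. x \<in> U \<Longrightarrow> w \<in> U \<Longrightarrow> b (c *\<^sub>R x) w = c * b x w"
    and bs2: "\<And>c x w. x \<in> U \<Longrightarrow> w \<in> U \<Longrightarrow> b w (c *\<^sub>R x) = c * b w x"
    and sym: "\<And>x y. x \<in> U \<Longrightarrow> y \<in> U \<Longrightarrow> b x y = b y x"
    and skew: "\<And>z x y. x \<in> U \<Longrightarrow> y \<in> U \<Longrightarrow> b (J z x) y + b x (J z y) = 0"
    using adm by (auto simp: admissible_module_def clifford_module_def bilinear_form_on_def
        linear_map_on_def)
  let ?B = "module_bracket J b"
  have psa: "psign (v + w) = psign v + psign w" and pss: "psign (c *\<^sub>R v) = c *\<^sub>R psign v"
    for v w :: "real ^ ('r + 's)" and c
    by (simp_all add: psign_def vec_eq_iff split: sum.split)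
  have pa: "pform z (v + w) = pform z v + pform z w" and ps: "pform z (c *\<^sub>R v) = c * pform z v"
    for z v w :: "real ^ ('r + 's)" and c
    by (simp_all add: pform_eq_inner psa pss inner_add_right)
  have p0: "pform z 0 = 0" for z :: "real ^ ('r + 's)"
    using ps[of z 0 0] by simp
  have a1: "?B (x + y) w = ?B x w + ?B y w" if "x \<in> U" "y \<in> U" "w \<in> U" for x y w
    by (rule pform_nondegenerate) (simp add: that pa Ua JU Ja ba1 flip: bw)
  have a2: "?B w (x + y) = ?B w x + ?B w y" if "x \<in> U" "y \<in> U" "w \<in> U" for x y w
    by (rule pform_nondegenerate) (simp add: that pa Ua JU ba2 flip: bw)
  have s1: "?B (c *\<^sub>R x) w = c *\<^sub>R ?B x w" if "x \<in> U" "w \<in> U" for x w c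
    by (rule pform_nondegenerate) (simp add: that ps Us JU Js bs1 flip: bw)
  have s2: "?B w (c *\<^sub>R x) = c *\<^sub>R ?B w x" if "x \<in> U" "w \<in> U" for x w c
    by (rule pform_nondegenerate) (simp add: that ps Us JU bs2 flip: bw)
  have alt: "?B x x = 0" if "x \<in> U" for x
  proof (rule pform_nondegenerate)
    fix z show "pform z (?B x x) = pform z 0"
      using skew[of x x z] sym[of x "J z x"] that JU[of x z] by (simp add: p0 flip: bw)
  qed
  have z1: "?B 0 x = 0" and z2: "?B x 0 = 0" if "x \<in> U" for x
    using s1[of 0 x 0] s2[of 0 x 0] U0 that by auto
  show ?thesis
    unfolding lie_algebra_on_def linear_map_on_def N_bracket_def
    by (auto simp: U U0 a1 a2 s1 s2 alt z1 z2 zero_prod_def intro: subspace_Times)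
qed

lemma minimal_admissible_dim_le:
  fixes U :: "'u::real_vector set" and W :: "'v::real_vector set"
    and J :: "real ^ ('r::finite + 's::finite) \<Rightarrow> 'u \<Rightarrow> 'u"
    and J' :: "real ^ ('r + 's) \<Rightarrow> 'v \<Rightarrow> 'v"
  assumes min: "minimal_admissible_module U J b"
    and adm: "admissible_module W J' b'" and "W \<noteq> {0}"
  shows "dim U \<le> dim W"
proof (rule ccontr)
  assume "\<not> dim U \<le> dim W"
  then have less: "dim W \<le> dim U" by linarith
  have "clifford_module W J'"
    using adm unfolding admissible_module_def by (rule conjunct1)
  then have "\<exists>K. finite K \<and> W = span K"
    unfolding clifford_module_def by (rule conjunct1)
  then obtain K where K: "finite K" "W = span K" by (elim exE conjE)
  have "subspace W" unfolding K(2) by (rule subspace_span)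
  obtain B where B: "B \<subseteq> U" "independent B" "U \<subseteq> span B" "card B = dim U"
    by (rule basis_exists)
  obtain C where C: "C \<subseteq> W" "independent C" "W \<subseteq> span C" "card C = dim W"
    by (rule basis_exists)
  have spanC: "span C = W"
    by (rule span_subspace[OF C(1) C(3) \<open>subspace W\<close>])
  have finC: "finite C"
    using independent_span_bound[OF K(1) C(2)] C(1) unfolding K(2) by blast
  obtain B' where B': "B' \<subseteq> B" "card B' = card C" "finite B'"
  proof -
    have "card C \<le> card B" using less B(4) C(4) by simp
    then show thesis using obtain_subset_with_card_n[of "card C" B] that by blast
  qed
  have indB': "independent B'" using B B' independent_mono by blast
  obtain h where h: "bij_betw h C B'"
    using finite_same_card_bij[OF finC B'(3)] B'(2) by auto
  obtain f where f: "linear f" "\<forall>x\<in>C. f x = h x"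
    using linear_independent_extend[OF C(2), of h] by blast
  obtain g where g: "linear g" "\<forall>x\<in>B'. g x = inv_into C h x"
    using linear_independent_extend[OF indB', of "inv_into C h"] by blast
  interpret f: linear f by (rule f)
  interpret g: linear g by (rule g)
  define V where "V = span B'"
  have fC: "f ` C = B'" using f h by (auto simp: bij_betw_def)
  have fW: "f ` W = V" unfolding V_def spanC[symmetric] fC[symmetric]
    by (rule linear_span_image[OF f(1), symmetric])
  have gf: "g (f x) = x" if "x \<in> W" for x
  proof -
    have "linear (g \<circ> f)" using f g linear_compose by blast
    moreover have "(g \<circ> f) x = id x" if "x \<in> C" for x
      using f g h that bij_betw_inv_into_left[OF h] by (auto simp: bij_betw_def)
    ultimately have "(g \<circ> f) x = id x"
      using that C(3) linear_eq_on_span[of "g \<circ> f" id C x] linear_id by blast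
    then show ?thesis by simp
  qed
  have fg: "f (g y) = y" if "y \<in> V" for y using that fW gf by auto
  have gV: "g y \<in> W" if "y \<in> V" for y using that fW gf by auto
  have fV: "f x \<in> V" if "x \<in> W" for x using that fW by auto
  have "admissible_module V (\<lambda>z x. f (J' z (g x))) (\<lambda>x y. b' (g x) (g y))"
  proof -
    have JW: "\<And>z x. x \<in> W \<Longrightarrow> J' z x \<in> W"
      and lin: "\<And>x. x \<in> W \<Longrightarrow> linear (\<lambda>z. J' z x)"
      using adm by (auto simp: admissible_module_def clifford_module_def linear_map_on_def)
    have 1: "\<exists>B. finite B \<and> V = span B" using B' V_def by blast
    have 2: "linear_map_on V V (\<lambda>x. f (J' z (g x)))" for z
      using adm by (auto simp: admissible_module_def clifford_module_def linear_map_on_def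
          gV fV g.add g.scale f.add f.scale)
    have 3: "linear (\<lambda>z. f (J' z (g x)))" if "x \<in> V" for x
      using linear_compose[OF lin[OF gV[OF that]] f(1)] by (simp add: o_def)
    have 4: "f (J' z (g (f (J' z (g x))))) = - pform z z *\<^sub>R x" if "x \<in> V" for x z
    proof -
      have "J' z (J' z (g x)) = - pform z z *\<^sub>R g x"
        using adm gV[OF that] by (auto simp: admissible_module_def clifford_module_def)
      then show ?thesis using that by (simp add: gf JW gV f.neg f.scale fg)
    qed
    have 5: "bilinear_form_on V (\<lambda>x y. b' (g x) (g y))"
      using adm by (auto simp: admissible_module_def bilinear_form_on_def linear_map_on_def
          gV g.add g.scale)
    have 6: "x = 0" if "x \<in> V" "\<forall>y\<in>V. b' (g x) (g y) = 0" for x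
    proof -
      have "\<forall>y\<in>W. b' (g x) y = 0" using that(2) fV gf by metis
      then have "g x = 0" using adm gV[OF that(1)] by (auto simp: admissible_module_def)
      then show ?thesis using fg[OF that(1)] f.zero by metis
    qed
    have 7: "b' (g (f (J' z (g x)))) (g y) + b' (g x) (g (f (J' z (g y)))) = 0"
      if "x \<in> V" "y \<in> V" for x y z
      using adm that by (auto simp: admissible_module_def gV gf JW)
    have 8: "b' (g x) (g y) = b' (g y) (g x)" if "x \<in> V" "y \<in> V" for x y
      using adm that by (auto simp: admissible_module_def gV)
    show ?thesis
      unfolding admissible_module_def clifford_module_def
      using 1 2 3 4 5 6 7 8 by blast
  qed
  moreover have "V \<noteq> {0}"
  proof
    assume "V = {0}"
    then have "\<forall>x\<in>W. x = 0" using gf fV g.zero by (metis singletonD)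
    moreover have "0 \<in> W" using spanC span_zero by blast
    ultimately show False using \<open>W \<noteq> {0}\<close> by blast
  qed
  ultimately have "dim U \<le> dim V"
    using min unfolding minimal_admissible_module_def by blast
  also have "dim V = dim W"
    using B' C indB' unfolding V_def by (simp add: dim_eq_card_independent)
  finally show False using \<open>\<not> dim U \<le> dim W\<close> by simp
qed

end

theory Submission
  imports Defs
begin

text \<open>
  Let \<open>e\<close>, \<open>f\<close> be orthogonal with \<open>\<langle>e,e\<rangle> = 1\<close>, \<open>\<langle>f,f\<rangle> = -1\<close>. Suppose that \<open>v\<close> is non-null and that
  \<open>J\<^sub>z J\<^sub>w v \<in> J\<^sub>e J\<^sub>Z v\<close> for all \<open>z, w \<in> Z = \<real>\<^bsup>r,r\<^esup>\<close> and \<open>J\<^sub>Z J\<^sub>Z v \<bottom> J\<^sub>Z v\<close>. Then \<open>X \<oplus> Y\<close> with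
  \<open>X = J\<^sub>e J\<^sub>Z v\<close> and \<open>Y = J\<^sub>Z v\<close> is an admissible submodule, hence all of \<open>U\<close> by minimality, and
  \<open>[X,X] = [Y,Y] = 0\<close>, so that the bracket \<open>X \<times> Y \<rightarrow> Z\<close> behaves like the product of a split
  composition algebra. With \<open>p = J\<^sub>e J\<^sub>f v \<in> X\<close>, which is orthogonal to \<open>v\<close> and has the opposite
  norm \<open>- c\<close>, the map \<open>A\<close> is the product of the reflections in \<open>p\<close> and \<open>v\<close> on \<open>X\<close> and sends \<open>J\<^sub>z v\<close> to
  \<open>J\<^sub>z p\<close> on \<open>Y\<close>; it induces \<open>C z = [p, J\<^sub>z v] / c\<close> on the centre. The identity
  \<open>[x, J\<^sub>z y] + [y, J\<^sub>z x] = 2 \<langle>x,y\<rangle> z\<close> shows that this is an automorphism with \<open>C\<^sup>2 = Id\<close> and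
  \<open>C\<^sup>\<tau> = - C\<close>.

  A suitable \<open>v\<close> is any non-null vector for \<open>r = 1\<close>, and a joint eigenvector of commuting symmetric
  involutions \<open>J\<^sub>i J\<^sub>j J\<^sub>k J\<^sub>l\<close> for \<open>r = 2, 4\<close>. For \<open>r = 4\<close> the index sets \<open>{i,j,k,l}\<close> are the weight 4 words
  of the extended Hamming code of length 8, that is the blocks of a Steiner system \<open>S(3,4,8)\<close>, so
  that each product \<open>J\<^sub>i J\<^sub>j v\<close> equals some \<open>J\<^sub>e J\<^sub>k v\<close> up to sign.
\<close>

section \<open>The indefinite form, its adjoint, and finite-dimensional subspaces\<close>

lemma psign_add: "psign (v + w) = psign v + psign w"
  by (simp add: psign_def vec_eq_iff split: sum.split)

lemma psign_scaleR: "psign (c *\<^sub>R v) = c *\<^sub>R psign v"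
  by (simp add: psign_def vec_eq_iff split: sum.split)

lemma pform_add_left: "pform (x + y) z = pform x z + pform y z"
  by (simp add: pform_eq_inner inner_add_left)

lemma pform_add_right: "pform z (x + y) = pform z x + pform z y"
  by (simp add: pform_eq_inner psign_add inner_add_right)

lemma pform_scaleR_right: "pform z (c *\<^sub>R x) = c * pform z x"
  by (simp add: pform_eq_inner psign_scaleR)

lemma pform_zero_right: "pform z 0 = 0"
  using pform_scaleR_right[of z 0 0] by simp

lemma pform_minus_right: "pform z (- x) = - pform z x"
  using pform_scaleR_right[of z "-1" x] by simp

lemma pform_commute: "pform x y = pform y x"
  by (simp add: pform_def mult.commute)

lemma pform_axis:
  "pform (axis i 1) (axis j 1) = (if i = j then (case i of Inl _ \<Rightarrow> 1 | Inr _ \<Rightarrow> - 1) else 0)"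
  by (simp add: pform_eq_inner inner_axis') (simp add: psign_def axis_def split: sum.split)

lemma pform_adjoint_eqI:
  assumes "\<And>x y. pform (C x) y = pform x (D y)"
  shows "pform_adjoint C = D"
  unfolding pform_adjoint_def
proof (rule the_equality)
  fix D' assume "\<forall>x y. pform (C x) y = pform x (D' y)"
  then have "pform x (D' y) = pform x (D y)" for x y
    using assms by metis
  then show "D' = D"
    by (intro ext pform_nondegenerate) blast
qed (use assms in blast)

text \<open>Reduces linear statements to the standard basis. With \<open>{0}\<close> for
  \<open>S\<close> it turns vanishing on the axes into vanishing everywhere.\<close>

lemma linear_mem_subspace_axis:
  fixes f :: "real ^ 'n \<Rightarrow> 'u::real_vector"
  assumes "linear f" "subspace S" "\<And>i. f (axis i 1) \<in> S"
  shows "f z \<in> S"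
proof -
  have "z = (\<Sum>i\<in>UNIV. z $ i *\<^sub>R axis i 1)"
    by (metis basis_expansion scalar_mult_eq_scaleR)
  then have "f z = (\<Sum>i\<in>UNIV. z $ i *\<^sub>R f (axis i 1))"
    by (metis (no_types, lifting) assms(1) linear_scale linear_sum sum.cong)
  then show ?thesis
    using assms(2,3) by (simp add: subspace_sum subspace_scale)
qed

text \<open>The ambient space may be infinite-dimensional, so finiteness comes from
  \<open>K\<close>: a basis of \<open>W\<close> extended to one of \<open>U\<close> gains no
  element.\<close>

lemma subspace_eq_of_dim_le:
  fixes U W :: "'u::real_vector set"
  assumes "subspace W" "W \<subseteq> U" "finite K" "U = span K" "dim U \<le> dim W"
  shows "W = U"
proof -
  obtain B where B: "B \<subseteq> W" "independent B" "W \<subseteq> span B" "card B = dim W"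
    by (rule basis_exists)
  obtain D where D: "B \<subseteq> D" "D \<subseteq> U" "independent D" "U \<subseteq> span D"
    using maximal_independent_subset_extend[of B U] B(1,2) assms(2) by blast
  have "finite D"
    using independent_span_bound[of K D] D assms by auto
  moreover have "card D = dim U"
    using D by (simp add: dim_unique)
  ultimately have "B = D"
    using D(1) B(4) assms(5) by (metis card_seteq)
  then have "U \<subseteq> span B"
    using D by simp
  also have "span B \<subseteq> W"
    using B(1) assms(1) by (simp add: span_minimal)
  finally show ?thesis
    using assms(2) by blast
qed

subsection \<open>Admissible modules\<close>

locale admissible =
  fixes U :: "'u::real_vector set"
    and J :: "real ^ ('r::finite + 's::finite) \<Rightarrow> 'u \<Rightarrow> 'u"
    and b :: "'u \<Rightarrow> 'u \<Rightarrow> real"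
  assumes adm: "admissible_module U J b"
begin

lemma subspace_U: "subspace U"
  using adm by (auto simp: admissible_module_def clifford_module_def)

lemma add_mem [simp]: "x \<in> U \<Longrightarrow> y \<in> U \<Longrightarrow> x + y \<in> U"
  and diff_mem [simp]: "x \<in> U \<Longrightarrow> y \<in> U \<Longrightarrow> x - y \<in> U"
  and scale_mem [simp]: "x \<in> U \<Longrightarrow> a *\<^sub>R x \<in> U"
  and minus_mem [simp]: "x \<in> U \<Longrightarrow> - x \<in> U"
  and zero_mem [simp]: "0 \<in> U"
  using subspace_U by (auto simp: subspace_add subspace_diff subspace_scale subspace_neg subspace_0)

lemma J_mem [simp]: "x \<in> U \<Longrightarrow> J z x \<in> U"
  and J_add: "x \<in> U \<Longrightarrow> y \<in> U \<Longrightarrow> J z (x + y) = J z x + J z y"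
  and J_scale: "x \<in> U \<Longrightarrow> J z (a *\<^sub>R x) = a *\<^sub>R J z x"
  and J_linear: "x \<in> U \<Longrightarrow> linear (\<lambda>z. J z x)"
  and J_square: "x \<in> U \<Longrightarrow> J z (J z x) = - pform z z *\<^sub>R x"
  using adm by (auto simp: admissible_module_def clifford_module_def linear_map_on_def)

lemma J_minus: "x \<in> U \<Longrightarrow> J z (- x) = - J z x"
  using J_scale[of x z "-1"] by simp

lemma J_zero: "J z 0 = 0"
  using J_scale[of 0 z 0] by simp

lemma J_add_left: "x \<in> U \<Longrightarrow> J (z + w) x = J z x + J w x"
  and J_scale_left: "x \<in> U \<Longrightarrow> J (a *\<^sub>R z) x = a *\<^sub>R J z x"
  and J_diff_left: "x \<in> U \<Longrightarrow> J (z - w) x = J z x - J w x"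
  and J_minus_left: "x \<in> U \<Longrightarrow> J (- z) x = - J z x"
  and J_zero_left: "x \<in> U \<Longrightarrow> J 0 x = 0"
  using linear_add[OF J_linear[of x]] linear_scale[OF J_linear[of x]]
    linear_diff[OF J_linear[of x]] linear_neg[OF J_linear[of x]] linear_0[OF J_linear[of x]]
  by blast+

lemma form_add_left: "x \<in> U \<Longrightarrow> y \<in> U \<Longrightarrow> w \<in> U \<Longrightarrow> b (x + y) w = b x w + b y w"
  and form_add_right: "x \<in> U \<Longrightarrow> y \<in> U \<Longrightarrow> w \<in> U \<Longrightarrow> b w (x + y) = b w x + b w y"
  and form_scale_left: "x \<in> U \<Longrightarrow> w \<in> U \<Longrightarrow> b (a *\<^sub>R x) w = a * b x w"
  and form_scale_right: "x \<in> U \<Longrightarrow> w \<in> U \<Longrightarrow> b w (a *\<^sub>R x) = a * b w x"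
  and form_commute: "x \<in> U \<Longrightarrow> y \<in> U \<Longrightarrow> b x y = b y x"
  and form_nondegenerate: "x \<in> U \<Longrightarrow> (\<And>y. y \<in> U \<Longrightarrow> b x y = 0) \<Longrightarrow> x = 0"
  using adm by (auto simp: admissible_module_def bilinear_form_on_def linear_map_on_def)

lemma J_skew: "x \<in> U \<Longrightarrow> y \<in> U \<Longrightarrow> b (J z x) y = - b x (J z y)"
  using adm by (force simp: admissible_module_def eq_neg_iff_add_eq_0)

lemma form_minus_left: "x \<in> U \<Longrightarrow> w \<in> U \<Longrightarrow> b (- x) w = - b x w"
  and form_minus_right: "x \<in> U \<Longrightarrow> w \<in> U \<Longrightarrow> b w (- x) = - b w x"
  using form_scale_left[of x w "-1"] form_scale_right[of x w "-1"] by auto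

lemma form_diff_left: "x \<in> U \<Longrightarrow> y \<in> U \<Longrightarrow> w \<in> U \<Longrightarrow> b (x - y) w = b x w - b y w"
  using form_add_left[of x "-y" w] by (simp add: form_minus_left)

lemma form_diff_right: "x \<in> U \<Longrightarrow> y \<in> U \<Longrightarrow> w \<in> U \<Longrightarrow> b w (x - y) = b w x - b w y"
  using form_add_right[of x "-y" w] by (simp add: form_minus_right)

lemma form_zero_left: "w \<in> U \<Longrightarrow> b 0 w = 0"
  and form_zero_right: "w \<in> U \<Longrightarrow> b w 0 = 0"
  using form_scale_left[of 0 w 0] form_scale_right[of 0 w 0] by auto

lemmas form_left = form_add_left form_diff_left form_scale_left form_minus_left form_zero_left
lemmas form_right = form_add_right form_diff_right form_scale_right form_minus_right form_zero_right

lemma J_anticommute: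
  assumes "x \<in> U"
  shows "J z (J w x) = - J w (J z x) - (2 * pform z w) *\<^sub>R x"
proof -
  have "J (z + w) (J (z + w) x) = - pform (z + w) (z + w) *\<^sub>R x"
    using J_square assms by blast
  then have "J z (J w x) + J w (J z x) = - (2 * pform z w) *\<^sub>R x"
    using assms pform_commute[of w z]
    by (simp add: J_add_left J_add J_square pform_add_left pform_add_right algebra_simps)
       (simp add: eq_neg_iff_add_eq_0 ac_simps)
  then have "J z (J w x) = - (2 * pform z w) *\<^sub>R x - J w (J z x)"
    by (simp only: eq_diff_eq)
  then show ?thesis
    by (simp only: diff_conv_add_uminus add.commute scaleR_minus_left)
qed

lemma J_anticommute_orthogonal:
  "pform z w = 0 \<Longrightarrow> x \<in> U \<Longrightarrow> J z (J w x) = - J w (J z x)"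
  by (simp add: J_anticommute[of x z w])

lemma form_J_self: "x \<in> U \<Longrightarrow> b (J z x) x = 0"
  using J_skew[of x x z] form_commute[of x "J z x"] by simp

text \<open>Skewness moves \<open>J z\<close> to the right argument, where the Clifford relation
  swaps it with \<open>J w\<close>. The bracket inherits this as \<open>br_J_polar\<close>.\<close>

lemma form_J_J_polar:
  assumes "x \<in> U" "y \<in> U"
  shows "b (J z x) (J w y) + b (J w x) (J z y) = 2 * pform z w * b x y"
proof -
  have "b x (J z (J w y)) = b x (- J w (J z y) + (- (2 * pform z w)) *\<^sub>R y)"
    using assms J_anticommute[of y z w] by simp
  also have "\<dots> = - b x (J w (J z y)) - 2 * pform z w * b x y"
    using assms by (simp only: form_right J_mem minus_mem scale_mem)
  finally show ?thesis
    using assms by (simp add: J_skew)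
qed

lemma form_J_J: "x \<in> U \<Longrightarrow> y \<in> U \<Longrightarrow> b (J z x) (J z y) = pform z z * b x y"
  using form_J_J_polar[of x y z z] by simp

lemma form_J_J_self: "x \<in> U \<Longrightarrow> b (J z x) (J w x) = pform z w * b x x"
  using form_J_J_polar[of x x z w] form_commute[of "J z x" "J w x"] by simp

section \<open>The bracket on the module\<close>

abbreviation br :: "'u \<Rightarrow> 'u \<Rightarrow> real ^ ('r + 's)" where
  "br \<equiv> module_bracket J b"

lemma pform_br: "x \<in> U \<Longrightarrow> y \<in> U \<Longrightarrow> pform z (br x y) = b (J z x) y"
  using module_bracket_works[OF adm] by simp

lemma br_add_left: "x \<in> U \<Longrightarrow> y \<in> U \<Longrightarrow> w \<in> U \<Longrightarrow> br (x + y) w = br x w + br y w"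
  and br_add_right: "x \<in> U \<Longrightarrow> y \<in> U \<Longrightarrow> w \<in> U \<Longrightarrow> br w (x + y) = br w x + br w y"
  and br_scale_left: "x \<in> U \<Longrightarrow> w \<in> U \<Longrightarrow> br (a *\<^sub>R x) w = a *\<^sub>R br x w"
  and br_scale_right: "x \<in> U \<Longrightarrow> w \<in> U \<Longrightarrow> br w (a *\<^sub>R x) = a *\<^sub>R br w x"
  by (rule pform_nondegenerate;
      simp add: pform_br pform_add_right pform_scaleR_right J_add J_scale form_left form_right)+

lemma br_minus_left: "x \<in> U \<Longrightarrow> w \<in> U \<Longrightarrow> br (- x) w = - br x w"
  and br_minus_right: "x \<in> U \<Longrightarrow> w \<in> U \<Longrightarrow> br w (- x) = - br w x"
  using br_scale_left[of x w "-1"] br_scale_right[of x w "-1"] by auto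

lemma br_diff_left: "x \<in> U \<Longrightarrow> y \<in> U \<Longrightarrow> w \<in> U \<Longrightarrow> br (x - y) w = br x w - br y w"
  and br_diff_right: "x \<in> U \<Longrightarrow> y \<in> U \<Longrightarrow> w \<in> U \<Longrightarrow> br w (x - y) = br w x - br w y"
  using br_add_left[of x "-y" w] br_add_right[of x "-y" w]
  by (simp_all add: br_minus_left br_minus_right)

lemmas br_linear = br_add_left br_add_right br_scale_left br_scale_right br_minus_left
  br_minus_right br_diff_left br_diff_right

lemma br_skew: "x \<in> U \<Longrightarrow> y \<in> U \<Longrightarrow> br x y = - br y x"
  by (rule pform_nondegenerate)
     (simp add: pform_br pform_minus_right J_skew[of y x] form_commute[of "J _ x" y])

lemma br_J_polar:
  assumes "x \<in> U" "y \<in> U"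
  shows "br x (J z y) + br y (J z x) = (2 * b x y) *\<^sub>R z"
proof (rule pform_nondegenerate)
  fix w
  have "b (J w y) (J z x) = b (J z x) (J w y)"
    using assms by (simp add: form_commute)
  then show "pform w (br x (J z y) + br y (J z x)) = pform w ((2 * b x y) *\<^sub>R z)"
    using assms form_J_J_polar[of x y w z]
    by (simp add: pform_br pform_add_right pform_scaleR_right)
qed

lemma br_J_self: "x \<in> U \<Longrightarrow> br x (J z x) = b x x *\<^sub>R z"
  using br_J_polar[of x x z] by (simp flip: scaleR_2 scaleR_scaleR)

subsection \<open>The automorphism determined by a suitable vector\<close>

text \<open>\<open>triple\<close> makes \<open>X\<close> orthogonal to Y and gives [Y,Y] = 0;
  \<open>closed\<close> makes every \<open>J z\<close> map \<open>X\<close> into Y, which together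
  with \<open>triple\<close> gives [X,X] = 0; \<open>decomp\<close> reduces the homomorphism
  property to pairs from \<open>X\<close> and Y.\<close>

lemma automorphism_exists:
  assumes v: "v \<in> U" and c: "b v v \<noteq> 0"
    and e: "pform e e = 1" and f: "pform f f = -1" and ef: "pform e f = 0"
    and triple: "\<And>z w u. b (J z (J w v)) (J u v) = 0"
    and closed: "\<And>z w. \<exists>s. J z (J w v) = J e (J s v)"
    and decomp: "\<And>u. u \<in> U \<Longrightarrow> \<exists>z w. u = J z v + J e (J w v)"
  shows "\<exists>A C. linear_map_on U U A \<and> linear C \<and>
           lie_algebra_automorphism_on (N_carrier U) (N_bracket J b) (map_prod A C) \<and>
           C \<circ> pform_adjoint C = (\<lambda>z. - z)"
proof -
  define c where "c = b v v"
  define p where "p = J e (J f v)"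
  define X where "X = {x. \<exists>w. x = J e (J w v)}"
  define C where "C = (\<lambda>z. (1 / c) *\<^sub>R br p (J z v))"
  \<comment> \<open>One formula on all of \<open>U\<close> avoids choosing decompositions. Sending
    \<open>u\<close> to \<open>(1 / c) *\<^sub>R J (br v u) v\<close> is the projection onto Y along
    \<open>X\<close>, so the first two corrections replace \<open>J z v\<close> by
    \<open>J z p\<close>; the last two are the reflections in \<open>p\<close> and \<open>v\<close>,
    where \<open>b p p = - c\<close> and \<open>b v v = c\<close>.\<close>
  define A where "A = (\<lambda>u. u - (1 / c) *\<^sub>R J (br v u) v + (1 / c) *\<^sub>R J (br v u) p
      + (2 / c * b p u) *\<^sub>R p - (2 / c * b v u) *\<^sub>R v)"
  have c0: "c \<noteq> 0" using c by (simp add: c_def)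
  have pU [simp]: "p \<in> U" and vU [simp]: "v \<in> U" using v by (simp_all add: p_def)
  have XU [simp]: "x \<in> U" if "x \<in> X" for x using that by (auto simp: X_def)
  have ee: "J e (J e x) = - x" if "x \<in> U" for x using J_square[of x e] e that by simp
  have "v = J e (J (- e) v)" by (simp add: J_minus_left J_minus ee)
  then have vX: "v \<in> X" unfolding X_def by blast
  have pX: "p \<in> X" by (auto simp: X_def p_def)
  have Xadd: "x + y \<in> X" if "x \<in> X" "y \<in> X" for x y
    using that unfolding X_def by clarsimp (metis J_add J_add_left J_mem v)
  have Xscale: "a *\<^sub>R x \<in> X" if "x \<in> X" for x a
    using that unfolding X_def by clarsimp (metis J_scale J_scale_left J_mem v)
  have Xdiff: "x - y \<in> X" if "x \<in> X" "y \<in> X" for x y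
    using Xadd[of x "-1 *\<^sub>R y"] Xscale[of y "-1"] that by simp
  have bpp: "b p p = - c"
    using e f by (simp add: p_def form_J_J c_def)
  have bpv: "b p v = 0" "b v p = 0"
  proof -
    have "b p v = - b (J f v) (J e v)" by (simp add: p_def J_skew)
    also have "\<dots> = 0" using form_J_J_self[of v f e] ef pform_commute[of e f] by simp
    finally show "b p v = 0" .
    then show "b v p = 0" using form_commute[of v p] by simp
  qed
  have vX0: "br v x = 0" if x: "x \<in> X" for x
  proof (rule pform_nondegenerate)
    fix z
    obtain w where "x = J e (J w v)" using x by (auto simp: X_def)
    then show "pform z (br v x) = pform z 0"
      using triple[of e w z] form_commute[of "J z v" x] by (simp add: pform_br pform_zero_right)
  qed
  have JX: "\<exists>s. J z x = J s v" if x: "x \<in> X" for x z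
  proof -
    obtain w where w: "x = J e (J w v)" using x by (auto simp: X_def)
    obtain s where s: "J z (J w v) = J e (J s v)" using closed by blast
    have "J z x = J s v - (2 * pform z e) *\<^sub>R J w v"
      by (simp add: w J_anticommute[of "J w v" z e] s ee)
    also have "\<dots> = J (s - (2 * pform z e) *\<^sub>R w) v"
      by (simp add: J_diff_left J_scale_left)
    finally show ?thesis by blast
  qed
  have XX: "br x y = 0" if "x \<in> X" "y \<in> X" for x y
  proof (rule pform_nondegenerate)
    fix z
    obtain s where "J z x = J s v" using JX \<open>x \<in> X\<close> by blast
    then have "pform z (br x y) = pform s (br v y)" using that by (simp add: pform_br)
    then show "pform z (br x y) = pform z 0" using vX0 that by (simp add: pform_zero_right)
  qed
  have YY: "br (J z v) (J w v) = 0" for z w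
    by (rule pform_nondegenerate) (simp add: pform_br triple pform_zero_right)
  have XY: "b x (J z v) = 0" if "x \<in> X" for x z
    using vX0[OF that] pform_br[of v x z] form_commute[of x "J z v"] that
    by (simp add: pform_zero_right)
  have brv: "br v (J z v) = c *\<^sub>R z" for z
    by (simp add: br_J_self c_def)
  have JvX: "J (br v (J z x)) v = c *\<^sub>R J z x" if "x \<in> X" for x z
    using JX[OF that, of z] by (auto simp: brv J_scale_left)
  have linC: "linear C"
    unfolding C_def
    by (rule linearI) (simp_all add: J_add_left J_scale_left br_linear algebra_simps)
  \<comment> \<open>As \<open>p\<close> and \<open>v\<close> are orthogonal,
    \<open>br_J_polar\<close> gives \<open>br p (J z v) = - br v (J z p)\<close>; and
    \<open>J z p\<close> lies in Y, so the projection onto Y fixes it.\<close>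
  have CJ: "J (C z) v = - J z p" for z
  proof -
    have "C z = - ((1 / c) *\<^sub>R br v (J z p))"
      using br_J_polar[of p v z] by (simp add: C_def bpv add_eq_0_iff)
    then show ?thesis
      using JvX[OF pX, of z] c0 by (simp add: J_minus_left J_scale_left)
  qed
  \<comment> \<open>By \<open>CJ\<close>, applying \<open>C\<close> twice gives
    \<open>- (1 / c) *\<^sub>R br p (J z p)\<close>, and the negative sign in
    \<open>b p p = - c\<close> turns this into \<open>z\<close>.\<close>
  have CC: "C (C z) = z" for z
    using br_J_self[of p z] c0
    by (simp add: C_def[THEN fun_cong, of "C z"] CJ br_minus_right bpp)
  have adj: "pform_adjoint C = (\<lambda>z. - C z)"
  proof (rule pform_adjoint_eqI)
    fix x y
    have "pform (C x) y + pform x (C y) = (b (J y p) (J x v) + b (J x p) (J y v)) / c"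
      unfolding pform_commute[of "C x" y]
      by (simp add: C_def pform_scaleR_right pform_br add_divide_distrib)
    then show "pform (C x) y = pform x (- C y)"
      using form_J_J_polar[of p v y x] by (simp add: bpv pform_minus_right)
  qed
  have AU: "A u \<in> U" if "u \<in> U" for u using that by (simp add: A_def)
  have Aadd: "A (x + y) = A x + A y" if "x \<in> U" "y \<in> U" for x y
    using that by (simp add: A_def br_linear J_add_left form_right algebra_simps add_divide_distrib)
  have Ascale: "A (a *\<^sub>R x) = a *\<^sub>R A x" if "x \<in> U" for x a
    using that by (simp add: A_def br_linear J_scale_left form_right algebra_simps)
  have AX: "A x = x + (2 / c * b p x) *\<^sub>R p - (2 / c * b v x) *\<^sub>R v" if "x \<in> X" for x
    using that by (simp add: A_def vX0 J_zero_left)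
  have AX_mem: "A x \<in> X" if "x \<in> X" for x
    using that vX pX by (simp add: AX Xadd Xdiff Xscale)
  have AY: "A (J z v) = J z p" for z
    using XY[OF pX] XY[OF vX] c0 by (simp add: A_def brv J_scale_left)
  have AY': "A (J z v) = - J (C z) v" for z
    by (simp add: AY CJ)
  have bp: "b p (A x) = - b p x" and bv: "b v (A x) = - b v x" if "x \<in> X" for x
    using that c0 by (simp_all add: AX form_right bpp bpv c_def[symmetric])
  have AAX: "A (A x) = x" if "x \<in> X" for x
    using that AX_mem[OF that]
    by (subst AX) (simp_all add: bp bv, simp add: AX)
  have AAY: "A (A (J z v)) = J z v" for z
    by (simp add: AY' J_minus_left[symmetric] linear_neg[OF linC, symmetric] CC)
  have dec: "\<exists>x\<in>X. \<exists>z. u = x + J z v" if "u \<in> U" for u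
  proof -
    obtain z w where "u = J z v + J e (J w v)" using decomp \<open>u \<in> U\<close> by blast
    moreover have "J e (J w v) \<in> X" unfolding X_def by blast
    ultimately show ?thesis using add.commute by metis
  qed
  have AA: "A (A u) = u" if "u \<in> U" for u
    using dec[OF that] AX_mem by (auto simp: Aadd AU AAX AAY)
  \<comment> \<open>Polarisation \<open>1\<close> produces a multiple of \<open>z\<close> that the
    reflection in \<open>p\<close> cancels through \<open>3\<close>; the reflection in
    \<open>v\<close> supplies through \<open>2\<close> the multiple of \<open>C z\<close> that
    \<open>4\<close> requires.\<close>
  have mixed: "br (A x) (A (J z v)) = C (br x (J z v))" if x: "x \<in> X" for x z
  proof -
    have 1: "br x (J z p) = (2 * b p x) *\<^sub>R z - br p (J z x)"
      using br_J_polar[of x p z] x form_commute[of x p] by (simp add: algebra_simps)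
    have 2: "br v (J z p) = - br p (J z v)"
      using br_J_polar[of p v z] by (simp add: bpv add_eq_0_iff)
    have 3: "br p (J z p) = - c *\<^sub>R z"
      by (simp add: br_J_self bpp)
    have 4: "br x (J z v) = (2 * b v x) *\<^sub>R z - br v (J z x)"
      using br_J_polar[of x v z] x form_commute[of x v] by (simp add: algebra_simps)
    have 5: "C (br v (J z x)) = br p (J z x)"
      using c0 x by (simp add: C_def JvX br_linear)
    have "br (A x) (A (J z v)) = br x (J z p) + (2 / c * b p x) *\<^sub>R br p (J z p)
        - (2 / c * b v x) *\<^sub>R br v (J z p)"
      using x by (simp add: AX AY br_linear)
    also have "\<dots> = (2 * b v x) *\<^sub>R C z - br p (J z x)"
      unfolding 1 2 3 using c0 by (simp add: C_def algebra_simps)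
    also have "\<dots> = C (br x (J z v))"
      unfolding 4 by (simp add: linear_diff[OF linC] linear_scale[OF linC] 5)
    finally show ?thesis .
  qed
  have hom: "br (A u) (A u') = C (br u u')" if u: "u \<in> U" "u' \<in> U" for u u'
  proof -
    obtain x z where x: "x \<in> X" "u = x + J z v" using dec u by blast
    obtain x' z' where x': "x' \<in> X" "u' = x' + J z' v" using dec u by blast
    have m: "br (A (J z v)) (A x') = C (br (J z v) x')"
      using mixed[OF x'(1), of z] br_skew[of "A (J z v)" "A x'"] br_skew[of "J z v" x'] x'
      by (simp add: AU linear_neg[OF linC])
    have "br (A u) (A u') = br (A x) (A x') + br (A x) (A (J z' v))
        + (br (A (J z v)) (A x') + br (A (J z v)) (A (J z' v)))"
      using x x' by (simp add: Aadd AU br_linear)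
    also have "\<dots> = C (br x x') + C (br x (J z' v)) + (C (br (J z v) x') + C (br (J z v) (J z' v)))"
      unfolding m mixed[OF x(1)]
      using x x' XX[OF AX_mem AX_mem, of x x'] YY[of "- C z" "- C z'"]
      by (simp add: XX YY AY' J_minus_left[symmetric] linear_0[OF linC])
    also have "\<dots> = C (br u u')"
      using x x' by (simp add: br_linear linear_add[OF linC])
    finally show ?thesis .
  qed
  have A0: "A 0 = 0" using Ascale[of 0 0] by simp
  have inv: "map_prod A C (map_prod A C q) = q" if "q \<in> N_carrier U" for q
    using that by (cases q) (simp add: AA CC)
  have mem: "map_prod A C q \<in> N_carrier U" if "q \<in> N_carrier U" for q
    using that by (cases q) (simp add: AU)
  have "bij_betw (map_prod A C) (N_carrier U) (N_carrier U)"
    using inv mem by (intro bij_betw_byWitness[where f' = "map_prod A C"]) auto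
  moreover have "linear_map_on (N_carrier U) (N_carrier U) (map_prod A C)"
    unfolding linear_map_on_def
    by (auto simp: AU Aadd Ascale linear_add[OF linC] linear_scale[OF linC])
  moreover have "map_prod A C (N_bracket J b q q') = N_bracket J b (map_prod A C q) (map_prod A C q')"
    if "q \<in> N_carrier U" "q' \<in> N_carrier U" for q q'
    using that by (cases q; cases q') (simp add: N_bracket_def A0 hom)
  ultimately have "lie_algebra_automorphism_on (N_carrier U) (N_bracket J b) (map_prod A C)"
    unfolding lie_algebra_automorphism_on_def by blast
  moreover have "linear_map_on U U A"
    unfolding linear_map_on_def by (simp add: AU Aadd Ascale)
  moreover have "C \<circ> pform_adjoint C = (\<lambda>z. - z)"
    by (rule ext) (simp add: adj linear_neg[OF linC] CC)
  ultimately show ?thesis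
    using linC by blast
qed

text \<open>The vectors of this shape form a nonzero admissible submodule \<open>W\<close>, so
  minimality forces equality with \<open>U\<close>. The form is nondegenerate on \<open>W\<close>
  because the two summands are orthogonal by \<open>triple\<close> and each carries
  \<open>b v v\<close> times the form of the centre.\<close>

lemma decomposition:
  assumes min: "minimal_admissible_module U J b"
    and v: "v \<in> U" and c: "b v v \<noteq> 0" and e: "pform e e = 1"
    and triple: "\<And>z w u. b (J z (J w v)) (J u v) = 0"
    and closed: "\<And>z w. \<exists>s. J z (J w v) = J e (J s v)"
    and u: "u \<in> U"
  shows "\<exists>z w. u = J z v + J e (J w v)"
proof -
  note [simp] = v
  define g where "g = (\<lambda>(z, w). J z v + J e (J w v))"
  define W where "W = range g"
  have ling: "linear g"
    unfolding g_def
    by (rule linearI) (auto simp: J_add_left J_scale_left J_add J_scale algebra_simps)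
  have subW: "subspace W"
    unfolding W_def by (intro linear_subspace_image ling subspace_UNIV)
  have spanW: "\<exists>K. finite K \<and> W = span K"
  proof (intro exI conjI)
    show "W = span (g ` Basis)"
      unfolding W_def by (simp add: linear_span_image[OF ling])
  qed simp
  have WU: "x \<in> U" if "x \<in> W" for x
    using that by (auto simp: W_def g_def)
  have W1: "J z v \<in> W" for z
    unfolding W_def g_def by (rule image_eqI[of _ _ "(z, 0)"]) (simp_all add: J_zero_left J_zero)
  have W2: "J e (J z v) \<in> W" for z
    unfolding W_def g_def by (rule image_eqI[of _ _ "(0, z)"]) (simp_all add: J_zero_left)
  have ee: "J e (J e x) = - x" if "x \<in> U" for x using J_square[of x e] e that by simp
  have JW: "J z x \<in> W" if x: "x \<in> W" for x z
  proof -
    obtain s t where st: "x = J s v + J e (J t v)" using x by (auto simp: W_def g_def)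
    obtain s' where s': "J z (J s v) = J e (J s' v)" using closed by blast
    obtain t' where t': "J z (J t v) = J e (J t' v)" using closed by blast
    have "J z x = J e (J s' v) + (J t' v - (2 * pform z e) *\<^sub>R J t v)"
      by (simp add: st J_add s' J_anticommute[of "J t v" z e] t' ee)
    then show ?thesis
      using W1 W2 subW by (simp add: subspace_add subspace_diff subspace_scale)
  qed
  have nondeg: "x = 0" if x: "x \<in> W" "\<And>y. y \<in> W \<Longrightarrow> b x y = 0" for x
  proof -
    obtain z w where zw: "x = J z v + J e (J w v)" using x by (auto simp: W_def g_def)
    have cross: "b (J s v) (J e (J t v)) = 0" for s t
      using triple[of e t s] form_commute[of "J s v" "J e (J t v)"] by simp
    have "pform s z * b v v = 0" for s
      using x(2)[OF W1[of s]]
      by (simp add: zw form_left triple form_J_J_self pform_commute[of s z])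
    then have "z = 0"
      using c by (intro pform_nondegenerate) (simp add: pform_zero_right)
    moreover have "pform s w * b v v = 0" for s
      using x(2)[OF W2[of s]] e
      by (simp add: zw form_left cross form_J_J form_J_J_self pform_commute[of s w])
    then have "w = 0"
      using c by (intro pform_nondegenerate) (simp add: pform_zero_right)
    ultimately show ?thesis
      by (simp add: zw J_zero_left J_zero)
  qed
  have "clifford_module W J"
    unfolding clifford_module_def linear_map_on_def
    using spanW by (simp add: WU JW J_add J_scale J_linear J_square)
  moreover have "bilinear_form_on W b"
    unfolding bilinear_form_on_def linear_map_on_def by (simp add: WU form_left form_right)
  moreover have "b x y = b y x" "b (J z x) y + b x (J z y) = 0" if "x \<in> W" "y \<in> W" for x y z
    using that by (simp_all add: WU form_commute[of x y] J_skew)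
  ultimately have "admissible_module W J b"
    unfolding admissible_module_def using nondeg by blast
  moreover have "W \<noteq> {0}"
  proof
    assume "W = {0}"
    then have "J e v = 0" using W1 by blast
    then have "v = 0" using ee[of v] by (simp add: J_zero)
    then show False using c by (simp add: form_zero_left)
  qed
  ultimately have dim: "dim U \<le> dim W"
    using min unfolding minimal_admissible_module_def by blast
  obtain K where K: "finite K" "U = span K"
    using adm by (auto simp: admissible_module_def clifford_module_def)
  have "W = U"
    by (rule subspace_eq_of_dim_le[OF subW _ K dim]) (use WU in blast)
  then show ?thesis
    using u by (auto simp: W_def g_def)
qed

subsection \<open>Joint eigenvectors of products of four generators\<close>

lemma nonnull_exists:
  assumes "U \<noteq> {0}"
  obtains v where "v \<in> U" "b v v \<noteq> 0"
proof -
  obtain x where x: "x \<in> U" "x \<noteq> 0" using assms zero_mem by blast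
  then obtain y where y: "y \<in> U" "b x y \<noteq> 0" using form_nondegenerate by blast
  have "b (x + y) (x + y) = b x x + 2 * b x y + b y y"
    using x y form_commute[of y x] by (simp add: form_left form_right)
  then have "b x x \<noteq> 0 \<or> b y y \<noteq> 0 \<or> b (x + y) (x + y) \<noteq> 0" using y by auto
  then show ?thesis using that x(1) y(1) add_mem by blast
qed

definition symmetric_involution :: "('u \<Rightarrow> 'u) \<Rightarrow> bool" where
  "symmetric_involution P \<longleftrightarrow>
     (\<forall>x\<in>U. P x \<in> U \<and> P (P x) = x) \<and>
     (\<forall>x\<in>U. \<forall>y\<in>U. P (x + y) = P x + P y \<and> b (P x) y = b x (P y)) \<and>
     (\<forall>a. \<forall>x\<in>U. P (a *\<^sub>R x) = a *\<^sub>R P x)"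

text \<open>The form is indefinite, so the induction must keep the vector non-null while projecting
  to an eigenspace of each further \<open>P\<close>. Commutation preserves the eigenvalues already
  obtained.\<close>

lemma joint_eigenvector:
  assumes "U \<noteq> {0}"
    and "\<And>P. P \<in> set Ps \<Longrightarrow> symmetric_involution P"
    and "\<And>P Q x. P \<in> set Ps \<Longrightarrow> Q \<in> set Ps \<Longrightarrow> x \<in> U \<Longrightarrow> P (Q x) = Q (P x)"
  shows "\<exists>v\<in>U. b v v \<noteq> 0 \<and> (\<forall>P\<in>set Ps. \<exists>s\<in>{1, -1}. P v = s *\<^sub>R v)"
  using assms(2,3)
proof (induction Ps)
  case Nil
  then show ?case using nonnull_exists[OF assms(1)] by auto
next
  case (Cons P Ps)
  have "\<exists>v\<in>U. b v v \<noteq> 0 \<and> (\<forall>Q\<in>set Ps. \<exists>s\<in>{1, -1}. Q v = s *\<^sub>R v)"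
  proof (rule Cons.IH)
    show "symmetric_involution Q" if "Q \<in> set Ps" for Q
      using Cons.prems(1) that by simp
    show "Q (R x) = R (Q x)" if "Q \<in> set Ps" "R \<in> set Ps" "x \<in> U" for Q R x
      by (rule Cons.prems(2)) (use that in simp_all)
  qed
  then obtain v where v: "v \<in> U" "b v v \<noteq> 0" "\<forall>Q\<in>set Ps. \<exists>s\<in>{1, -1}. Q v = s *\<^sub>R v"
    by blast
  have P: "symmetric_involution P" using Cons.prems by simp
  then have Pv [simp]: "P v \<in> U" and PP: "P (P v) = v"
    and b: "b (P v) v = b v (P v)" "b (P v) (P v) = b v v"
    using v by (auto simp: symmetric_involution_def)
  \<comment> \<open>Parallelogram law for the isometry \<open>P\<close>: the two eigencomponents of
    \<open>v\<close> cannot both be null.\<close>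
  have "b (v + P v) (v + P v) + b (v - P v) (v - P v) = 4 * b v v"
    using v b by (simp add: form_left form_right)
  then have "\<exists>t\<in>{1, -1}. b (v + t *\<^sub>R P v) (v + t *\<^sub>R P v) \<noteq> 0"
    using v(2) by auto
  then obtain t where t: "t \<in> {1, -1}" "b (v + t *\<^sub>R P v) (v + t *\<^sub>R P v) \<noteq> 0" by blast
  let ?w = "v + t *\<^sub>R P v"
  have "P ?w = P v + t *\<^sub>R v"
    using P v(1) PP by (simp add: symmetric_involution_def)
  also have "\<dots> = t *\<^sub>R ?w"
    using t(1) by (auto simp: scaleR_add_right add.commute)
  finally have "P ?w = t *\<^sub>R ?w" .
  moreover have "\<exists>s\<in>{1, -1}. Q ?w = s *\<^sub>R ?w" if Q: "Q \<in> set Ps" for Q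
  proof -
    obtain s where s: "s \<in> {1, -1}" "Q v = s *\<^sub>R v" using v(3) Q by blast
    have "Q (P v) = P (Q v)" by (rule Cons.prems(2)) (use Q v(1) in simp_all)
    also have "\<dots> = s *\<^sub>R P v" using P v(1) s(2) by (simp add: symmetric_involution_def)
    finally have "Q (P v) = s *\<^sub>R P v" .
    moreover have "symmetric_involution Q" using Cons.prems(1) Q by simp
    ultimately have "Q ?w = s *\<^sub>R ?w"
      using v(1) s(2) by (simp add: symmetric_involution_def scaleR_add_right)
    then show ?thesis using s(1) by blast
  qed
  moreover have "?w \<in> U" using v(1) by simp
  ultimately show ?case using t by (intro bexI[of _ ?w]) auto
qed

section \<open>Orthogonal generators and their fourfold products\<close>

abbreviation E :: "'r + 's \<Rightarrow> 'u \<Rightarrow> 'u" where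
  "E i \<equiv> J (axis i 1)"

lemma E_anticommute: "i \<noteq> j \<Longrightarrow> x \<in> U \<Longrightarrow> E i (E j x) = - E j (E i x)"
  by (rule J_anticommute_orthogonal) (simp_all add: pform_axis)

lemma E_square_sign:
  "\<exists>s\<in>{1, -1}. \<forall>x\<in>U. E i (E i x) = s *\<^sub>R x"
proof (intro bexI ballI)
  let ?s = "- pform (axis i 1) (axis i 1 :: real ^ ('r + 's))"
  show "?s \<in> {1, -1}" by (simp add: pform_axis split: sum.split)
  show "E i (E i x) = ?s *\<^sub>R x" if "x \<in> U" for x
    using that by (rule J_square)
qed

definition E4 :: "'r + 's \<Rightarrow> 'r + 's \<Rightarrow> 'r + 's \<Rightarrow> 'r + 's \<Rightarrow> 'u \<Rightarrow> 'u" where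
  "E4 i j k l x = E i (E j (E k (E l x)))"

lemma E4_mem [simp]: "x \<in> U \<Longrightarrow> E4 i j k l x \<in> U"
  by (simp add: E4_def)

lemma E4_minus: "x \<in> U \<Longrightarrow> E4 i j k l (- x) = - E4 i j k l x"
  by (simp add: E4_def J_minus)

text \<open>Passing \<open>E m\<close> through the four generators costs one sign for each generator
  different from it: three signs if \<open>m\<close> is in the block, four otherwise.\<close>

lemma E4_E:
  assumes "distinct [i, j, k, l]" "x \<in> U"
  shows "E4 i j k l (E m x) =
    (if m \<in> {i, j, k, l} then - E m (E4 i j k l x) else E m (E4 i j k l x))"
proof -
  have m: "E n (E m y) = - E m (E n y)" if "n \<noteq> m" "y \<in> U" for n y
    using that by (rule E_anticommute)
  consider "i = m" | "j = m" | "k = m" | "l = m" | "m \<notin> {i, j, k, l}"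
    by blast
  then show ?thesis
    unfolding E4_def by cases (use assms in \<open>simp_all add: m m[OF not_sym] J_minus\<close>)
qed

text \<open>Reversing four anticommuting factors takes six transpositions, and the four signs from
  skewness cancel; this gives symmetry. The square is then the product of the four squares, which is
  1 when the block has an even number of negative generators.\<close>

lemma symmetric_involution_E4:
  assumes "distinct [i, j, k, l]"
    and "pform (axis i 1) (axis i 1 :: real ^ ('r + 's)) * pform (axis j 1) (axis j 1 :: real ^ ('r + 's)) *
      pform (axis k 1) (axis k 1 :: real ^ ('r + 's)) * pform (axis l 1) (axis l 1 :: real ^ ('r + 's)) = 1"
  shows "symmetric_involution (E4 i j k l)"
proof -
  have ac: "E l (E i y) = - E i (E l y)" "E l (E j y) = - E j (E l y)" "E l (E k y) = - E k (E l y)"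
    "E k (E i y) = - E i (E k y)" "E k (E j y) = - E j (E k y)" "E j (E i y) = - E i (E j y)"
    if "y \<in> U" for y
    by (rule E_anticommute; use assms(1) that in auto)+
  show ?thesis
    unfolding symmetric_involution_def
  proof (intro conjI ballI allI)
    fix x assume x: "x \<in> U"
    show "E4 i j k l (E4 i j k l x) = x"
      using x assms(2) by (simp add: E4_def ac J_minus J_scale J_square mult_ac)
  next
    fix x y assume "x \<in> U" "y \<in> U"
    then show "b (E4 i j k l x) y = b x (E4 i j k l y)"
      by (simp add: E4_def J_skew ac J_minus form_minus_right)
  qed (simp_all add: E4_def J_add J_scale)
qed

text \<open>Each of \<open>m\<close>, \<open>n\<close>, \<open>p\<close>, \<open>q\<close> inside
  \<open>{i, j, k, l}\<close> contributes a sign, so an even overlap makes the products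
  commute.\<close>

lemma E4_commute:
  assumes "distinct [i, j, k, l]"
    and "even (length (filter (\<lambda>t. t \<in> {i, j, k, l}) [m, n, p, q]))" and x: "x \<in> U"
  shows "E4 i j k l (E4 m n p q x) = E4 m n p q (E4 i j k l x)"
proof -
  define A where "A = {i, j, k, l}"
  define \<sigma> :: "'r + 's \<Rightarrow> real" where "\<sigma> t = (if t \<in> A then - 1 else 1)" for t
  have E: "E4 i j k l (E t y) = \<sigma> t *\<^sub>R E t (E4 i j k l y)" if "y \<in> U" for t y
    using E4_E[OF assms(1) that, of t] by (simp add: \<sigma>_def A_def)
  have "E4 i j k l (E4 m n p q x) = (\<sigma> m * \<sigma> n * \<sigma> p * \<sigma> q) *\<^sub>R E4 m n p q (E4 i j k l x)"
    unfolding E4_def[of m n p q] using x by (simp add: E J_scale)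
  also have "\<sigma> m * \<sigma> n * \<sigma> p * \<sigma> q = 1"
    using assms(2) unfolding A_def[symmetric] \<sigma>_def
    by (cases "m \<in> A"; cases "n \<in> A"; cases "p \<in> A"; cases "q \<in> A") simp_all
  finally show ?thesis by simp
qed

lemma form_symmetric_involution:
  "symmetric_involution P \<Longrightarrow> x \<in> U \<Longrightarrow> y \<in> U \<Longrightarrow> b (P x) (P y) = b x y"
  by (simp add: symmetric_involution_def)

text \<open>\<open>sim v i j k l\<close> depends on \<open>{i, j, k, l}\<close> only: it says that \<open>v\<close> is an eigenvector of \<open>E4 i j k l\<close>.\<close>

definition sim :: "'u \<Rightarrow> 'r + 's \<Rightarrow> 'r + 's \<Rightarrow> 'r + 's \<Rightarrow> 'r + 's \<Rightarrow> bool" where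
  "sim v i j k l \<longleftrightarrow> distinct [i, j, k, l] \<and> (\<exists>s\<in>{1, -1}. E i (E j v) = s *\<^sub>R E k (E l v))"

context
  fixes v assumes v [simp]: "v \<in> U"
begin

lemma sim_of_eigenvector:
  assumes "distinct [i, j, k, l]" "\<exists>s\<in>{1, -1}. E4 i j k l v = s *\<^sub>R v"
  shows "sim v i j k l"
proof -
  obtain s where s: "s \<in> {1, -1}" "E i (E j (E k (E l v))) = s *\<^sub>R v"
    using assms(2) unfolding E4_def by blast
  obtain p where p: "p \<in> {1, -1}" "\<forall>x\<in>U. E i (E i x) = p *\<^sub>R x"
    using E_square_sign by blast
  obtain q where q: "q \<in> {1, -1}" "\<forall>x\<in>U. E j (E j x) = q *\<^sub>R x"
    using E_square_sign by blast
  \<comment> \<open>Applying \<open>E i\<close> and then \<open>E j\<close> strips the first two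
    factors on the left, up to the signs \<open>p\<close> and \<open>q\<close> of their
    squares.\<close>
  have "E j (E i (E i (E j (E k (E l v))))) = s *\<^sub>R E j (E i v)"
    by (simp add: s J_scale)
  then have "(p * q) *\<^sub>R E k (E l v) = - s *\<^sub>R E i (E j v)"
    using assms(1) E_anticommute[OF not_sym, of i j v] by (simp add: p q J_scale)
  then have "E i (E j v) = (- s * p * q) *\<^sub>R E k (E l v)"
    using s(1) p(1) q(1) by auto
  moreover have "- s * p * q \<in> {1, -1}" using s(1) p(1) q(1) by auto
  ultimately show ?thesis using assms(1) unfolding sim_def by blast
qed

lemma sim_sym: "sim v i j k l \<Longrightarrow> sim v k l i j"
  unfolding sim_def by auto

text \<open>On index sets this is the symmetric difference of two blocks meeting in
  \<open>{k, l}\<close>, that is, addition in the code.\<close>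

lemma sim_trans:
  assumes "sim v i j k l" "sim v k l m n" "distinct [i, j, m, n]"
  shows "sim v i j m n"
  using assms unfolding sim_def by auto

lemma sim_flip: "sim v i j k l \<Longrightarrow> sim v j i k l"
  unfolding sim_def using E_anticommute[OF not_sym, of i j v] by auto

text \<open>Together with \<open>sim_flip\<close> and \<open>sim_sym\<close> this yields all
  permutations of the four indices.\<close>

lemma sim_exchange:
  assumes "sim v i j k l"
  shows "sim v i k j l"
proof -
  have d: "distinct [i, j, k, l]" using assms by (simp add: sim_def)
  obtain s where s: "s \<in> {1, -1}" "E i (E j v) = s *\<^sub>R E k (E l v)"
    using assms unfolding sim_def by blast
  obtain p where p: "p \<in> {1, -1}" "\<forall>x\<in>U. E j (E j x) = p *\<^sub>R x"
    using E_square_sign by blast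
  obtain q where q: "q \<in> {1, -1}" "\<forall>x\<in>U. E k (E k x) = q *\<^sub>R x"
    using E_square_sign by blast
  \<comment> \<open>The same vector is evaluated twice: once by bringing the two factors
    \<open>E j\<close> together, once by using the relation for \<open>E i (E j v)\<close>, which
    brings two factors \<open>E k\<close> together.\<close>
  have "E j (E k (E i (E j v))) = - p *\<^sub>R E i (E k v)"
    using d E_anticommute[of i j v] E_anticommute[OF not_sym, of j k "E i v"]
      E_anticommute[OF not_sym, of i k v]
    by (simp add: J_minus p)
  moreover have "E j (E k (E i (E j v))) = (s * q) *\<^sub>R E j (E l v)"
    by (simp add: s J_scale q)
  ultimately have "E i (E k v) = (- s * p * q) *\<^sub>R E j (E l v)"
    using s(1) p(1) q(1) by auto
  moreover have "- s * p * q \<in> {1, -1}" using s(1) p(1) q(1) by auto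
  ultimately show ?thesis using d unfolding sim_def by auto
qed

lemma closed_refl: "\<exists>s. E i (E i v) = E e (J s v)"
proof -
  obtain p where p: "p \<in> {1, -1}" "\<forall>x\<in>U. E i (E i x) = p *\<^sub>R x"
    using E_square_sign by blast
  obtain q where q: "q \<in> {1, -1}" "\<forall>x\<in>U. E e (E e x) = q *\<^sub>R x"
    using E_square_sign by blast
  have "E i (E i v) = E e (J ((p * q) *\<^sub>R axis e 1) v)"
    using p(1) q(1) by (auto simp: J_scale_left J_scale p(2) q(2) J_minus_left J_minus)
  then show ?thesis by blast
qed

lemma closed_base: "\<exists>s. E e (E i v) = E e (J s v)" "\<exists>s. E i (E e v) = E e (J s v)"
proof -
  show "\<exists>s. E e (E i v) = E e (J s v)" by blast
  show "\<exists>s. E i (E e v) = E e (J s v)"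
  proof (cases "i = e")
    case False
    then have "E i (E e v) = E e (J (- axis i 1) v)"
      using E_anticommute[of i e v] by (simp add: J_minus_left J_minus)
    then show ?thesis by blast
  qed (use closed_refl in blast)
qed

text \<open>For distinct \<open>x\<close>, \<open>y\<close> among \<open>i\<close>,
  \<open>j\<close>, \<open>k\<close>, the vector \<open>E x (E y v)\<close> is, up to sign,
  \<open>E e\<close> applied to the generator of the third index; the six arrangements cover all
  ordered pairs.\<close>

lemma closed_of_sim:
  assumes "sim v e i j k"
  shows "\<forall>x\<in>{e, i, j, k}. \<forall>y\<in>{e, i, j, k}. \<exists>s. E x (E y v) = E e (J s v)"
proof -
  have *: "\<exists>s. E y (E z v) = E e (J s v)" if "sim v e x y z" for x y z
  proof -
    obtain s where "s \<in> {1, -1}" "E e (E x v) = s *\<^sub>R E y (E z v)"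
      using \<open>sim v e x y z\<close> unfolding sim_def by blast
    then have "E y (E z v) = E e (J (s *\<^sub>R axis x 1) v)"
      by (auto simp: J_scale_left J_scale J_minus_left J_minus)
    then show ?thesis by blast
  qed
  have "sim v e i j k" "sim v e j i k" "sim v e i k j" "sim v e k i j" "sim v e j k i" "sim v e k j i"
    using assms sim_exchange sim_flip sim_sym by meson+
  from this[THEN *] show ?thesis
    using closed_refl closed_base by simp
qed

section \<open>Reduction to basis vectors\<close>

lemma closed_of_axes:
  assumes "\<And>i j. \<exists>s. E i (E j v) = J e (J s v)"
  shows "\<exists>s. J z (J w v) = J e (J s v)"
proof -
  define S where "S = range (\<lambda>s. J e (J s v))"
  have "linear (\<lambda>s. J e (J s v))"
    by (rule linearI) (simp_all add: J_add_left J_scale_left J_add J_scale)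
  then have S: "subspace S"
    unfolding S_def by (intro linear_subspace_image subspace_UNIV)
  have EE: "E i (E j v) \<in> S" for i j
    using assms[of i j] unfolding S_def by blast
  have JE: "J z (E j v) \<in> S" for j
    by (rule linear_mem_subspace_axis[OF J_linear S EE]) simp
  have lin: "linear (\<lambda>w. J z (J w v))"
    by (rule linearI) (simp_all add: J_add_left J_scale_left J_add J_scale)
  have "J z (J w v) \<in> S"
    by (rule linear_mem_subspace_axis[OF lin S JE])
  then show ?thesis unfolding S_def by blast
qed

text \<open>If two of the three indices coincide, skewness alone makes the expression vanish.
  Linearity then extends the vanishing one variable at a time.\<close>

lemma triple_of_axes:
  assumes "\<And>i j k. distinct [i, j, k] \<Longrightarrow> b (E i (E j v)) (E k v) = 0"
  shows "b (J z (J w v)) (J u v) = 0"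
proof -
  have two: "b (E i (E i v)) (E k v) = 0" "b (E i (E k v)) (E k v) = 0" for i k
    using form_J_self[of v "axis k 1"] form_J_self[of "E k v" "axis i 1"]
      form_commute[of v "E k v"]
    by (simp_all add: J_square form_minus_left form_scale_left)
  have ends: "b (E i (E j v)) (E i v) = 0" for i j
    using two[of i i] two(1)[of i j] E_anticommute[of i j v] J_skew[of "E i v" "E i v" "axis j 1"]
      form_J_self[of "E i v" "axis j 1"]
    by (cases "i = j") (simp_all add: form_minus_left)
  have 1: "b (E i (E j v)) (E k v) = 0" for i j k
    using assms[of i j k] two ends by (cases "distinct [i, j, k]") auto
  have 0: "subspace {0 :: real}" by simp
  have "linear (\<lambda>u. b (E i (E j v)) (J u v))" for i j
    by (rule linearI) (simp_all add: J_add_left J_scale_left form_right)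
  then have 2: "b (E i (E j v)) (J u v) \<in> {0}" for i j
    by (rule linear_mem_subspace_axis[OF _ 0]) (simp add: 1)
  have "linear (\<lambda>w. b (E i (J w v)) (J u v))" for i
    by (rule linearI) (simp_all add: J_add_left J_scale_left J_add J_scale form_left)
  then have 3: "b (E i (J w v)) (J u v) \<in> {0}" for i
    by (rule linear_mem_subspace_axis[OF _ 0]) (rule 2)
  have "linear (\<lambda>z. b (J z (J w v)) (J u v))"
    by (rule linearI) (simp_all add: J_add_left J_scale_left form_left)
  then have "b (J z (J w v)) (J u v) \<in> {0}"
    by (rule linear_mem_subspace_axis[OF _ 0]) (rule 3)
  then show ?thesis by simp
qed

text \<open>
  For \<open>r\<close> even, the volume element of the Clifford algebra can play the role of \<open>P\<close>.
\<close>

lemma triple_of_volume: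
  assumes "\<And>x. x \<in> U \<Longrightarrow> P x \<in> U"
    and iso: "\<And>x y. x \<in> U \<Longrightarrow> y \<in> U \<Longrightarrow> b (P x) (P y) = b x y"
    and anti: "\<And>i x. x \<in> U \<Longrightarrow> P (E i x) = - E i (P x)"
    and eig: "\<exists>s\<in>{1, -1}. P v = s *\<^sub>R v"
  shows "b (E i (E j v)) (E k v) = 0"
proof -
  obtain s where s: "s \<in> {1, -1}" "P v = s *\<^sub>R v" using eig by blast
  have "b (E i (E j v)) (E k v) = b (P (E i (E j v))) (P (E k v))"
    by (simp add: iso)
  \<comment> \<open>Three generators pass through \<open>P\<close>, giving an odd number of signs,
    while \<open>s\<close> occurs twice and cancels.\<close>
  also have "\<dots> = - b (E i (E j v)) (E k v)"
    using s(1) by (auto simp: anti s J_scale J_minus form_left form_right)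
  finally show ?thesis by simp
qed

lemma automorphism_of_axes:
  assumes "minimal_admissible_module U J b" "b v v \<noteq> 0"
    and "\<And>i j k. distinct [i, j, k] \<Longrightarrow> b (E i (E j v)) (E k v) = 0"
    and "\<And>i j. \<exists>s. E i (E j v) = E (Inl a) (J s v)"
  shows "\<exists>A C. linear_map_on U U A \<and> linear C \<and>
           lie_algebra_automorphism_on (N_carrier U) (N_bracket J b) (map_prod A C) \<and>
           C \<circ> pform_adjoint C = (\<lambda>z. - z)"
proof -
  note triple = triple_of_axes[OF assms(3)]
  note closed = closed_of_axes[OF assms(4)]
  have e: "pform (axis (Inl a) 1) (axis (Inl a) 1 :: real ^ ('r + 's)) = 1"
    by (simp add: pform_axis)
  show ?thesis
    \<comment> \<open>Any negative axis can serve as \<open>f\<close>; \<open>Inr undefined\<close>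
      is an arbitrary one.\<close>
    by (rule automorphism_exists[of v "axis (Inl a) 1" "axis (Inr undefined) 1"])
       (use assms(2) triple closed decomposition[OF assms(1) v assms(2) e triple closed]
        in \<open>simp_all add: pform_axis\<close>)
qed

end

subsection \<open>The signatures (1,1), (2,2) and (4,4)\<close>

lemma automorphism_signature_1_1:
  assumes min: "minimal_admissible_module U J b"
    and univ: "UNIV = {a :: 'r}" "UNIV = {p :: 's}"
  shows "\<exists>A C. linear_map_on U U A \<and> linear C \<and>
           lie_algebra_automorphism_on (N_carrier U) (N_bracket J b) (map_prod A C) \<and>
           C \<circ> pform_adjoint C = (\<lambda>z. - z)"
proof -
  have "U \<noteq> {0}" using min by (simp add: minimal_admissible_module_def)
  then obtain v where v: "v \<in> U" "b v v \<noteq> 0" by (rule nonnull_exists)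
  have idx: "i = Inl a \<or> i = Inr p" for i :: "'r + 's"
    using univ by (cases i) blast+
  show ?thesis
  proof (rule automorphism_of_axes[OF v(1) min v(2)])
    \<comment> \<open>There are only two indices, so three cannot be distinct.\<close>
    show "b (E i (E j v)) (E k v) = 0" if "distinct [i, j, k]" for i j k
      using that idx[of i] idx[of j] idx[of k] by auto
    show "\<exists>s. E i (E j v) = E (Inl a) (J s v)" for i j
      using idx[of i] idx[of j] closed_base[OF v(1)] closed_refl[OF v(1)] by metis
  qed
qed

lemma automorphism_signature_2_2:
  assumes min: "minimal_admissible_module U J b"
    and univ: "UNIV = {a, a' :: 'r}" "a \<noteq> a'" "UNIV = {p, p' :: 's}" "p \<noteq> p'"
  shows "\<exists>A C. linear_map_on U U A \<and> linear C \<and>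
           lie_algebra_automorphism_on (N_carrier U) (N_bracket J b) (map_prod A C) \<and>
           C \<circ> pform_adjoint C = (\<lambda>z. - z)"
proof -
  \<comment> \<open>The single block is the whole index set, so \<open>?P\<close> is both the volume
    element and the involution whose eigenvector yields \<open>sim\<close>.\<close>
  let ?P = "E4 (Inl a) (Inl a') (Inr p) (Inr p')"
  have d: "distinct [Inl a, Inl a', Inr p, Inr p']" using univ by simp
  have P: "symmetric_involution ?P"
    by (rule symmetric_involution_E4[OF d]) (simp add: pform_axis)
  have "U \<noteq> {0}" using min by (simp add: minimal_admissible_module_def)
  then have "\<exists>v\<in>U. b v v \<noteq> 0 \<and> (\<forall>P\<in>set [?P]. \<exists>s\<in>{1, -1}. P v = s *\<^sub>R v)"
    by (rule joint_eigenvector) (use P in simp_all)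
  then obtain v where v: "v \<in> U" "b v v \<noteq> 0" "\<exists>s\<in>{1, -1}. ?P v = s *\<^sub>R v" by auto
  have idx: "i \<in> {Inl a, Inl a', Inr p, Inr p'}" for i :: "'r + 's"
    using univ by (cases i) blast+
  show ?thesis
  proof (rule automorphism_of_axes[OF v(1) min v(2)])
    show "b (E i (E j v)) (E k v) = 0" for i j k
    proof (rule triple_of_volume[OF v(1) _ form_symmetric_involution[OF P] _ v(3)])
      show "?P (E i x) = - E i (?P x)" if "x \<in> U" for i x
        using E4_E[OF d that, of i] idx[of i] by simp
    qed simp
    show "\<exists>s. E i (E j v) = E (Inl a) (J s v)" for i j
      using closed_of_sim[OF v(1) sim_of_eigenvector[OF v(1) d v(3)]] idx[of i] idx[of j] by blast
  qed
qed

lemma automorphism_signature_4_4: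
  assumes min: "minimal_admissible_module U J b"
    and a: "UNIV = {a\<^sub>1, a\<^sub>2, a\<^sub>3, a\<^sub>4 :: 'r}" "distinct [a\<^sub>1, a\<^sub>2, a\<^sub>3, a\<^sub>4]"
    and p: "UNIV = {p\<^sub>1, p\<^sub>2, p\<^sub>3, p\<^sub>4 :: 's}" "distinct [p\<^sub>1, p\<^sub>2, p\<^sub>3, p\<^sub>4]"
  shows "\<exists>A C. linear_map_on U U A \<and> linear C \<and>
           lie_algebra_automorphism_on (N_carrier U) (N_bracket J b) (map_prod A C) \<and>
           C \<circ> pform_adjoint C = (\<lambda>z. - z)"
proof -
  define i0 i1 i2 i3 i4 i5 i6 i7 :: "'r + 's"
    where i_def: "i0 = Inl a\<^sub>1" "i1 = Inl a\<^sub>2" "i2 = Inl a\<^sub>3" "i3 = Inl a\<^sub>4"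
      "i4 = Inr p\<^sub>1" "i5 = Inr p\<^sub>2" "i6 = Inr p\<^sub>3" "i7 = Inr p\<^sub>4"
  have dist: "distinct [i0, i1, i2, i3, i4, i5, i6, i7]"
    using a(2) p(2) by (auto simp: i_def)
  have idx: "j \<in> {i0, i1, i2, i3, i4, i5, i6, i7}" for j
  proof (cases j)
    case (Inl x)
    then show ?thesis using a(1) UNIV_I[of x] by (auto simp: i_def)
  next
    case (Inr x)
    then show ?thesis using p(1) UNIV_I[of x] by (auto simp: i_def)
  qed
  \<comment> \<open>These four blocks generate the code. Any two meet in zero or two points, so the
    involutions commute, and each contains an even number of negative generators.\<close>
  let ?P = "E4 i0 i1 i2 i3" and ?Q = "E4 i4 i5 i6 i7" and ?R = "E4 i0 i1 i4 i5" and ?S = "E4 i0 i2 i4 i6"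
  have d: "distinct [i0, i1, i2, i3]" "distinct [i4, i5, i6, i7]" "distinct [i0, i1, i4, i5]"
    "distinct [i0, i2, i4, i6]"
    using dist by auto
  have inv: "symmetric_involution ?P" "symmetric_involution ?Q" "symmetric_involution ?R"
    "symmetric_involution ?S"
    by (rule symmetric_involution_E4; use d in \<open>simp add: i_def pform_axis\<close>)+
  have comm: "?P (?Q x) = ?Q (?P x)" "?P (?R x) = ?R (?P x)" "?P (?S x) = ?S (?P x)"
    "?Q (?R x) = ?R (?Q x)" "?Q (?S x) = ?S (?Q x)" "?R (?S x) = ?S (?R x)" if "x \<in> U" for x
    by (rule E4_commute[OF _ _ that]; use dist in auto)+
  have "U \<noteq> {0}" using min by (simp add: minimal_admissible_module_def)
  then have "\<exists>v\<in>U. b v v \<noteq> 0 \<and> (\<forall>P\<in>set [?P, ?Q, ?R, ?S]. \<exists>s\<in>{1, -1}. P v = s *\<^sub>R v)"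
  proof (rule joint_eigenvector)
    show "symmetric_involution P" if "P \<in> set [?P, ?Q, ?R, ?S]" for P
      using that inv by auto
    show "F (G x) = G (F x)" if "F \<in> set [?P, ?Q, ?R, ?S]" "G \<in> set [?P, ?Q, ?R, ?S]" "x \<in> U" for F G x
      using that(1,2) comm[OF that(3)] by auto
  qed
  then obtain v where v: "v \<in> U" "b v v \<noteq> 0"
    and eig: "\<exists>s\<in>{1, -1}. ?P v = s *\<^sub>R v" "\<exists>s\<in>{1, -1}. ?Q v = s *\<^sub>R v"
      "\<exists>s\<in>{1, -1}. ?R v = s *\<^sub>R v" "\<exists>s\<in>{1, -1}. ?S v = s *\<^sub>R v"
    by auto
  note sim = sim_of_eigenvector[OF v(1)] and exch = sim_exchange[OF v(1)] and flip = sim_flip[OF v(1)]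
    and sym = sim_sym[OF v(1)] and trans = sim_trans[OF v(1)]
  \<comment> \<open>The seven blocks through \<open>0\<close>, with bitwise xor as the group structure on the indices.\<close>
  have 0123: "sim v i0 i1 i2 i3" and 4567: "sim v i4 i5 i6 i7" and 0145: "sim v i0 i1 i4 i5"
    and 0246: "sim v i0 i2 i4 i6"
    by (rule sim; use d eig in blast)+
  have 0167: "sim v i0 i1 i6 i7"
    by (rule trans[OF 0145 4567]) (use dist in auto)
  have 0257: "sim v i0 i2 i5 i7"
    by (rule trans[OF 0246 exch[OF 4567]]) (use dist in auto)
  \<comment> \<open>An auxiliary block avoiding \<open>i0\<close>, from which \<open>0356\<close> is
    derived.\<close>
  have 1526: "sim v i1 i5 i2 i6"
    by (rule trans[OF sym[OF exch[OF 0145]] exch[OF 0246]]) (use dist in auto)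
  have 0312: "sim v i0 i3 i1 i2"
    by (rule sym[OF exch[OF flip[OF 0123]]])
  have 0356: "sim v i0 i3 i5 i6"
    by (rule trans[OF 0312 exch[OF 1526]]) (use dist in auto)
  have 0347: "sim v i0 i3 i4 i7"
    by (rule trans[OF 0356 exch[OF flip[OF 4567]]]) (use dist in auto)
  show ?thesis
  proof (rule automorphism_of_axes[OF v(1) min v(2)])
    \<comment> \<open>up to sign, the product of all eight generators\<close>
    let ?V = "\<lambda>x. ?P (?Q x)"
    show "b (E i (E j v)) (E k v) = 0" for i j k
    proof (rule triple_of_volume[where P = ?V, OF v(1)])
      show "b (?V x) (?V y) = b x y" if "x \<in> U" "y \<in> U" for x y
        using that inv by (simp add: form_symmetric_involution)
      \<comment> \<open>Each index lies in exactly one of the two blocks, so \<open>E i\<close>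
        anticommutes with one factor and commutes with the other.\<close>
      show "?V (E i x) = - E i (?V x)" if "x \<in> U" for i x
        using idx[of i] dist that
        by (cases "i \<in> {i0, i1, i2, i3}") (auto simp: E4_E[OF d(1)] E4_E[OF d(2)] E4_minus)
      show "\<exists>s\<in>{1, -1}. ?V v = s *\<^sub>R v"
      proof -
        obtain s t where "s \<in> {1, -1}" "?P v = s *\<^sub>R v" "t \<in> {1, -1}" "?Q v = t *\<^sub>R v"
          using eig by blast
        then show ?thesis using v(1) by (auto simp: E4_minus)
      qed
    qed simp
    show "\<exists>s. E i (E j v) = E (Inl a\<^sub>1) (J s v)" for i j
    proof -
      note sims = 0123 0145 0167 0246 0257 0347 0356
      note closed = sims[THEN closed_of_sim[OF v(1)]]
      \<comment> \<open>The Steiner property: any two indices lie in a common block through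
        \<open>i0\<close>.\<close>
      have "(i \<in> {i0, i1, i2, i3} \<and> j \<in> {i0, i1, i2, i3}) \<or> (i \<in> {i0, i1, i4, i5} \<and> j \<in> {i0, i1, i4, i5}) \<or>
        (i \<in> {i0, i1, i6, i7} \<and> j \<in> {i0, i1, i6, i7}) \<or> (i \<in> {i0, i2, i4, i6} \<and> j \<in> {i0, i2, i4, i6}) \<or>
        (i \<in> {i0, i2, i5, i7} \<and> j \<in> {i0, i2, i5, i7}) \<or> (i \<in> {i0, i3, i4, i7} \<and> j \<in> {i0, i3, i4, i7}) \<or>
        (i \<in> {i0, i3, i5, i6} \<and> j \<in> {i0, i3, i5, i6})"
        using idx[of i] idx[of j] unfolding insert_iff by blast
      then show ?thesis
        unfolding i_def(1)[symmetric] by (elim disjE conjE) (rule closed[THEN bspec, THEN bspec]; assumption)+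
    qed
  qed
qed

end

theorem theorem6:
  fixes U :: "'u::real_vector set"
    and J :: "real ^ ('r::finite + 'r) \<Rightarrow> 'u \<Rightarrow> 'u"
    and b :: "'u \<Rightarrow> 'u \<Rightarrow> real"
  assumes "CARD('r) \<in> {1, 2, 4}"
    and "minimal_admissible_module U J b"
  shows "\<exists>A C. linear_map_on U U A \<and> linear C \<and>
           lie_algebra_automorphism_on (N_carrier U) (N_bracket J b) (map_prod A C) \<and>
           C \<circ> pform_adjoint C = (\<lambda>z. - z)"
proof -
  interpret admissible U J b
    using assms(2) by unfold_locales (simp add: minimal_admissible_module_def)
  note min = assms(2)
  consider "card (UNIV :: 'r set) = 1" | "card (UNIV :: 'r set) = 2" | "card (UNIV :: 'r set) = 4"
    using assms(1) by auto
  then show ?thesis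
  proof cases
    case 1
    then obtain a where "UNIV = {a :: 'r}" by (rule card_1_singletonE)
    then show ?thesis using automorphism_signature_1_1[OF min] by blast
  next
    case 2
    then obtain a a' where "UNIV = {a, a' :: 'r}" "a \<noteq> a'" by (auto simp: card_2_iff)
    then show ?thesis using automorphism_signature_2_2[OF min] by blast
  next
    case 3
    then have "card (UNIV :: 'r set) = Suc 3" by simp
    then obtain a B where B: "UNIV = insert (a :: 'r) B" "a \<notin> B" "card B = 3"
      by (elim card_eq_SucD[elim_format] exE conjE)
    obtain x y z where "B = {x, y, z}" "x \<noteq> y" "y \<noteq> z" "x \<noteq> z"
      using B(3) unfolding card_3_iff by blast
    then have "UNIV = {a, x, y, z}" "distinct [a, x, y, z]" using B by auto
    then show ?thesis using automorphism_signature_4_4[OF min] by blast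
  qed
qed

end
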